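(* Suppose that for some function $A(\cdot)$, parameters $\theta_1,\theta_2$ and function $H(\cdot,\cdot)$, the random vector $X$ has density $$p(x\mid\theta_1,\theta_2)=H(\theta_1,\theta_2)\exp\{\theta_1^T x-\theta_2^T A(x)\}.$$ Suppose also that there exist functions $h(\cdot)$, $T(\cdot)$ and a parameter $\theta_3$ such that $$p(z\mid x,\theta_3)=h(z)\exp\{x^T T(z)-\theta_3^T A(x)\}$$ is a well-defined probability density in $z$ (for every $x$). Draw $Z$, conditionally on $X$, from the density $p(z\mid X,\theta_3)$, and let $f(X):=Z$ and $g(X):=X$. Then $f(X)$ has marginal density $$p(z\mid\theta_1,\theta_2,\theta_3)=h(z)\,\frac{H(\theta_1,\theta_2)}{H(\theta_1+T(z),\theta_2+\theta_3)},$$ and the conditional density of $g(X)=X$ given $f(X)=z$ is $$p(x\mid z,\theta_1,\theta_2,\theta_3)=p(x\mid\theta_1+T(z),\theta_2+\theta_3),$$ so that, up to knowledge of the parameters, $f(X)$ has a known marginal distribution and $g(X)$ has a known conditional distribution given $f(X)$.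
   Context: $X$ takes values in a Euclidean space with densities taken with respect to a fixed reference measure (e.g. Lebesgue measure $dx$); densities of $Z$ are with respect to a fixed reference measure on the space of $z$ (e.g. Lebesgue or counting measure). $A$ and $T$ are vector-valued with dimensions making the inner products meaningful. $H$ is the normalizing function of the exponential family: $H(\eta_1,\eta_2)=\left(\int \exp\{\eta_1^T x-\eta_2^T A(x)\}\,dx\right)^{-1}$ for parameters at which the integral is finite, and $p(x\mid\eta_1,\eta_2)=H(\eta_1,\eta_2)\exp\{\eta_1^Tx-\eta_2^TA(x)\}$ for such parameters. As usual, identities between densities are understood almost everywhere (on $\{z: h(z)>0\}$ for those involving $z$). *)

theory Defs
  imports "HOL-Probability.Probability"
begin

definition exp_family_finite ::
    "'a::euclidean_space measure \<Rightarrow> ('a \<Rightarrow> 'b::euclidean_space) \<Rightarrow> 'a \<Rightarrow> 'b \<Rightarrow> bool" where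
  "exp_family_finite \<mu> A \<eta>1 \<eta>2 \<longleftrightarrow> integrable \<mu> (\<lambda>x. exp (\<eta>1 \<bullet> x - \<eta>2 \<bullet> A x))"

(* Only meaningful where exp_family_finite holds; otherwise the integral, hence also its
   inverse, is 0 by convention. *)
definition exp_family_H ::
    "'a::euclidean_space measure \<Rightarrow> ('a \<Rightarrow> 'b::euclidean_space) \<Rightarrow> 'a \<Rightarrow> 'b \<Rightarrow> real" where
  "exp_family_H \<mu> A \<eta>1 \<eta>2 = inverse (\<integral>x. exp (\<eta>1 \<bullet> x - \<eta>2 \<bullet> A x) \<partial>\<mu>)"

definition exp_family_density ::
    "'a::euclidean_space measure \<Rightarrow> ('a \<Rightarrow> 'b::euclidean_space) \<Rightarrow> 'a \<Rightarrow> 'b \<Rightarrow> 'a \<Rightarrow> real" where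
  "exp_family_density \<mu> A \<eta>1 \<eta>2 x = exp_family_H \<mu> A \<eta>1 \<eta>2 * exp (\<eta>1 \<bullet> x - \<eta>2 \<bullet> A x)"

definition prob_density :: "'a measure \<Rightarrow> ('a \<Rightarrow> real) \<Rightarrow> bool" where
  "prob_density R f \<longleftrightarrow> has_bochner_integral R f 1 \<and> (AE x in R. 0 \<le> f x)"

(* k y is a density with respect to R of the conditional distribution of X given Y = y,
   for almost every value y of Y: for each measurable B,
   P(X in B | sigma(Y)) = (integral of k Y over B) almost surely.
   Here vimage_algebra (space M) Y S is the sigma-algebra generated by Y.
   As usual, k is determined, and required to be a density, only up to null sets. *)
definition has_conditional_density ::
    "'w measure \<Rightarrow> 'b measure \<Rightarrow> ('w \<Rightarrow> 'b) \<Rightarrow> 'c measure \<Rightarrow> ('w \<Rightarrow> 'c) \<Rightarrow> ('c \<Rightarrow> 'b \<Rightarrow> real) \<Rightarrow> bool" where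
  "has_conditional_density M R X S Y k \<longleftrightarrow>
     X \<in> measurable M R \<and> Y \<in> measurable M S \<and>
     (AE \<omega> in M. prob_density R (k (Y \<omega>))) \<and>
     (\<forall>B\<in>sets R. AE \<omega> in M.
        real_cond_exp M (vimage_algebra (space M) Y S) (indicator (X -` B \<inter> space M)) \<omega>
          = (LINT x:B|R. k (Y \<omega>) x))"

end

(* By Bayes' rule (X, Z) has joint density p(x) k(x, z), where k(x, z) = h(z) exp(x.T(z) - theta3.A(x)).
   As a function of x it is proportional to exp((theta1 + T(z)).x - (theta2 + theta3).A(x)), so
   integrating out x yields the marginal of Z, and normalizing yields the conditional density of X.
   Tonelli needs k to be jointly measurable, though neither T nor A is assumed measurable; this
   follows from the normalization of k(x, .). *)

theory Submission
  imports Defs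
begin

section \<open>Densities, conditional densities and the law of a pair\<close>

lemma subalgebra_vimage_algebra:
  assumes "Y \<in> measurable M S"
  shows "subalgebra M (vimage_algebra (space M) Y S)"
  using assms measurable_space[OF assms]
  by (auto simp: subalgebra_def sets_vimage_algebra2 intro: measurable_sets)

text \<open>Points where the density vanishes form a null set for the law of \<open>Y\<close>, so
  \<open>P\<close> has to be checked only where \<open>f\<close> is positive.\<close>

lemma distributed_AE:
  assumes "distributed M S Y f" and "AE y in S. 0 < f y \<longrightarrow> P y"
  shows "AE \<omega> in M. P (Y \<omega>)"
proof (rule AE_distrD[where f = Y])
  show "Y \<in> measurable M S" using assms(1) by (rule distributed_measurable)
  show "AE y in distr M S Y. P y"
    unfolding distributed_distr_eq_density[OF assms(1)]
    using assms(2) AE_density[OF distributed_borel_measurable[OF assms(1)]] by blast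
qed

text \<open>Passes from the Bochner integrals in \<open>has_conditional_density\<close> to the
  nonnegative integrals that Tonelli requires. The density may be negative on a null set, so the
  argument is almost everywhere.\<close>

lemma prob_density_set_nn_integral:
  assumes "prob_density R f" and B: "B \<in> sets R"
  shows "ennreal (LINT x:B|R. f x) = (\<integral>\<^sup>+x\<in>B. ennreal (f x) \<partial>R)" and "0 \<le> (LINT x:B|R. f x)"
proof -
  have f: "integrable R f" "AE x in R. 0 \<le> f x"
    using assms by (auto simp: prob_density_def has_bochner_integral_iff)
  have i: "integrable R (\<lambda>x. indicator B x *\<^sub>R f x)"
    using integrable_mult_indicator[OF B f(1)] .
  have nn: "AE x in R. 0 \<le> indicator B x *\<^sub>R f x"
    using f(2) by (auto simp: indicator_def)
  have "ennreal (LINT x:B|R. f x) = (\<integral>\<^sup>+x. ennreal (indicator B x *\<^sub>R f x) \<partial>R)"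
    unfolding set_lebesgue_integral_def using nn_integral_eq_integral[OF i nn] by simp
  also have "\<dots> = (\<integral>\<^sup>+x\<in>B. ennreal (f x) \<partial>R)"
    by (intro nn_integral_cong) (auto simp: indicator_def)
  finally show "ennreal (LINT x:B|R. f x) = (\<integral>\<^sup>+x\<in>B. ennreal (f x) \<partial>R)" .
  show "0 \<le> (LINT x:B|R. f x)"
    unfolding set_lebesgue_integral_def using nn by (rule integral_nonneg_AE)
qed

text \<open>The kernel enters the definition only through its sections at the values of
  \<open>Y\<close>.\<close>

lemma has_conditional_density_cong_AE:
  assumes "has_conditional_density M R X S Y k" and "AE \<omega> in M. k (Y \<omega>) = k' (Y \<omega>)"
  shows "has_conditional_density M R X S Y k'"
proof -
  have pd: "AE \<omega> in M. prob_density R (k (Y \<omega>))"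
    and B: "\<And>B. B \<in> sets R \<Longrightarrow> AE \<omega> in M.
        real_cond_exp M (vimage_algebra (space M) Y S) (indicator (X -` B \<inter> space M)) \<omega>
          = (LINT x:B|R. k (Y \<omega>) x)"
    using assms(1) by (auto simp: has_conditional_density_def)
  have "AE \<omega> in M. prob_density R (k' (Y \<omega>))"
    using pd assms(2) by eventually_elim simp
  moreover have "AE \<omega> in M.
        real_cond_exp M (vimage_algebra (space M) Y S) (indicator (X -` B \<inter> space M)) \<omega>
          = (LINT x:B|R. k' (Y \<omega>) x)" if "B \<in> sets R" for B
    using B[OF that] assms(2) by eventually_elim simp
  ultimately show ?thesis
    using assms(1) by (auto simp: has_conditional_density_def)
qed

text \<open>The event that \<open>Y\<close> lies in \<open>C\<close> belongs to the sigma-algebra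
  generated by \<open>Y\<close>, so the indicator of \<open>X\<close> in \<open>B\<close> may be
  replaced on it by its conditional expectation. The density of \<open>Y\<close> then turns the
  expectation into an integral over \<open>S\<close>.\<close>

lemma (in prob_space) has_conditional_density_emeasure_rectangle:
  assumes R: "sigma_finite_measure R"
    and Y: "distributed M S Y p"
    and k: "has_conditional_density M R X S Y k"
    and km [measurable]: "case_prod k \<in> borel_measurable (S \<Otimes>\<^sub>M R)"
    and C [measurable]: "C \<in> sets S" and B [measurable]: "B \<in> sets R"
  shows "emeasure M (Y -` C \<inter> X -` B \<inter> space M)
    = (\<integral>\<^sup>+y\<in>C. (\<integral>\<^sup>+x\<in>B. p y * ennreal (k y x) \<partial>R) \<partial>S)"
proof -
  interpret R: sigma_finite_measure R by fact
  have [measurable]: "Y \<in> measurable M S" "X \<in> measurable M R"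
    using k by (auto simp: has_conditional_density_def)
  have [measurable]: "p \<in> borel_measurable S"
    using Y by (simp add: distributed_def)
  let ?F = "vimage_algebra (space M) Y S"
  interpret F: finite_measure_subalgebra M ?F
    by unfold_locales (rule subalgebra_vimage_algebra, measurable)
  let ?ind = "indicator (X -` B \<inter> space M) :: _ \<Rightarrow> real"
  define D where "D = Y -` C \<inter> space M"
  have DF: "D \<in> sets ?F" unfolding D_def by (rule in_vimage_algebra) fact
  have D [measurable]: "D \<in> sets M" unfolding D_def by measurable
  have int: "integrable M ?ind" by (simp add: emeasure_eq_measure)
  have Dreal: "measure M (D \<inter> (X -` B \<inter> space M)) = (LINT \<omega>:D|M. ?ind \<omega>)"
  proof -
    have "(\<lambda>\<omega>. indicator D \<omega> *\<^sub>R ?ind \<omega>) = indicator (D \<inter> (X -` B \<inter> space M))"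
      by (auto simp: indicator_def)
    then show ?thesis by (simp add: set_lebesgue_integral_def)
  qed
  have pd: "AE \<omega> in M. prob_density R (k (Y \<omega>))"
    and ce: "AE \<omega> in M. real_cond_exp M ?F ?ind \<omega> = (LINT x:B|R. k (Y \<omega>) x)"
    using k B by (auto simp: has_conditional_density_def)
  \<comment> \<open>The conditional expectation is almost surely the integral of a probability
    density over \<open>B\<close>, hence nonnegative.\<close>
  have nn: "AE \<omega> in M. 0 \<le> indicator D \<omega> *\<^sub>R real_cond_exp M ?F ?ind \<omega>"
    using pd ce by eventually_elim (auto simp: prob_density_set_nn_integral(2)[OF _ B])
  have i: "integrable M (\<lambda>\<omega>. indicator D \<omega> *\<^sub>R real_cond_exp M ?F ?ind \<omega>)"
    by (intro integrable_mult_indicator D F.real_cond_exp_int int)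
  have "emeasure M (Y -` C \<inter> X -` B \<inter> space M) = ennreal (measure M (D \<inter> (X -` B \<inter> space M)))"
    unfolding D_def by (simp add: emeasure_eq_measure Int_ac)
  also have "\<dots> = ennreal (LINT \<omega>:D|M. real_cond_exp M ?F ?ind \<omega>)"
    unfolding Dreal using F.real_cond_exp_intA[OF int DF] by simp
  also have "\<dots> = (\<integral>\<^sup>+\<omega>. ennreal (indicator D \<omega> *\<^sub>R real_cond_exp M ?F ?ind \<omega>) \<partial>M)"
    unfolding set_lebesgue_integral_def using nn_integral_eq_integral[OF i nn] by simp
  also have "\<dots> = (\<integral>\<^sup>+\<omega>. indicator C (Y \<omega>) * (\<integral>\<^sup>+x\<in>B. ennreal (k (Y \<omega>) x) \<partial>R) \<partial>M)"
  proof (rule nn_integral_cong_AE)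
    show "AE \<omega> in M. ennreal (indicator D \<omega> *\<^sub>R real_cond_exp M ?F ?ind \<omega>)
        = indicator C (Y \<omega>) * (\<integral>\<^sup>+x\<in>B. ennreal (k (Y \<omega>) x) \<partial>R)"
      using pd ce AE_space
    proof eventually_elim
      case (elim \<omega>)
      then show ?case
        using prob_density_set_nn_integral[OF elim(1) B]
        by (auto simp: indicator_def D_def)
    qed
  qed
  also have "\<dots> = (\<integral>\<^sup>+y. p y * (indicator C y * (\<integral>\<^sup>+x\<in>B. ennreal (k y x) \<partial>R)) \<partial>S)"
    by (rule distributed_nn_integral[OF Y, symmetric]) measurable
  also have "\<dots> = (\<integral>\<^sup>+y\<in>C. (\<integral>\<^sup>+x\<in>B. p y * ennreal (k y x) \<partial>R) \<partial>S)"
  proof (rule nn_integral_cong)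
    fix y assume y [measurable]: "y \<in> space S"
    have "(\<integral>\<^sup>+x\<in>B. p y * ennreal (k y x) \<partial>R) = p y * (\<integral>\<^sup>+x\<in>B. ennreal (k y x) \<partial>R)"
      by (subst nn_integral_cmult[symmetric]) (auto simp: mult.assoc)
    then show "p y * (indicator C y * (\<integral>\<^sup>+x\<in>B. ennreal (k y x) \<partial>R))
      = (\<integral>\<^sup>+x\<in>B. p y * ennreal (k y x) \<partial>R) * indicator C y"
      by (simp add: ac_simps)
  qed
  finally show ?thesis .
qed

section \<open>Marginal and conditional densities from a joint density\<close>

context prob_space
begin

text \<open>\<open>rectangle\<close> makes \<open>J\<close> the joint density of (\<open>Y\<close>,
  \<open>X\<close>). Rectangles suffice because conditional expectations given \<open>Y\<close> are
  tested on preimages of sets \<open>C\<close> under \<open>Y\<close>.\<close>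

context
  fixes S :: "'c measure" and R :: "'b measure" and X Y J
  assumes R: "sigma_finite_measure R"
    and Y [measurable]: "Y \<in> measurable M S" and X [measurable]: "X \<in> measurable M R"
    and J [measurable]: "case_prod J \<in> borel_measurable (S \<Otimes>\<^sub>M R)"
    and J_nonneg: "\<And>y x. (0::real) \<le> J y x"
    and rectangle: "\<And>C B. C \<in> sets S \<Longrightarrow> B \<in> sets R \<Longrightarrow>
      emeasure M (Y -` C \<inter> X -` B \<inter> space M) = (\<integral>\<^sup>+y\<in>C. (\<integral>\<^sup>+x\<in>B. ennreal (J y x) \<partial>R) \<partial>S)"
begin

text \<open>The iterated integral of \<open>J\<close> is the total mass of \<open>M\<close>; being
  finite, it forces almost every inner integral to be finite.\<close>

lemma joint_density_integrable: "AE y in S. integrable R (J y)"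
proof -
  interpret R: sigma_finite_measure R by (rule R)
  have "(\<integral>\<^sup>+y. (\<integral>\<^sup>+x. ennreal (J y x) \<partial>R) \<partial>S)
      = (\<integral>\<^sup>+y\<in>space S. (\<integral>\<^sup>+x\<in>space R. ennreal (J y x) \<partial>R) \<partial>S)"
    by (auto intro!: nn_integral_cong simp: indicator_def)
  also have "\<dots> = emeasure M (Y -` space S \<inter> X -` space R \<inter> space M)"
    by (rule rectangle[symmetric]) auto
  finally have "(\<integral>\<^sup>+y. (\<integral>\<^sup>+x. ennreal (J y x) \<partial>R) \<partial>S) \<noteq> \<infinity>"
    by (simp add: emeasure_eq_measure)
  then have "AE y in S. (\<integral>\<^sup>+x. ennreal (J y x) \<partial>R) \<noteq> \<infinity>"
    by (intro nn_integral_PInf_AE) auto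
  with AE_space show ?thesis
  proof eventually_elim
    case (elim y)
    from elim(1) have [measurable]: "J y \<in> borel_measurable R" by measurable
    show ?case
      using elim(2) J_nonneg by (intro integrableI_nonneg) (auto simp: less_top)
  qed
qed

text \<open>Take \<open>B\<close> to be the whole of \<open>R\<close> in
  \<open>rectangle\<close>.\<close>

lemma joint_density_marginal: "distributed M S Y (\<lambda>y. ennreal (LINT x|R. J y x))"
proof -
  interpret R: sigma_finite_measure R by (rule R)
  have "distr M S Y = density S (\<lambda>y. ennreal (LINT x|R. J y x))"
  proof (rule measure_eqI)
    fix C assume "C \<in> sets (distr M S Y)"
    then have C [measurable]: "C \<in> sets S" by simp
    have "emeasure (distr M S Y) C = emeasure M (Y -` C \<inter> X -` space R \<inter> space M)"
      using measurable_space[OF X] by (auto simp: emeasure_distr intro!: arg_cong[where f = "emeasure M"])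
    also have "\<dots> = (\<integral>\<^sup>+y\<in>C. (\<integral>\<^sup>+x\<in>space R. ennreal (J y x) \<partial>R) \<partial>S)"
      by (rule rectangle) auto
    also have "\<dots> = (\<integral>\<^sup>+y\<in>C. ennreal (LINT x|R. J y x) \<partial>S)"
    proof (rule nn_integral_cong_AE)
      show "AE y in S. (\<integral>\<^sup>+x\<in>space R. ennreal (J y x) \<partial>R) * indicator C y
          = ennreal (LINT x|R. J y x) * indicator C y"
        using joint_density_integrable
      proof eventually_elim
        case (elim y)
        have "(\<integral>\<^sup>+x\<in>space R. ennreal (J y x) \<partial>R) = (\<integral>\<^sup>+x. ennreal (J y x) \<partial>R)"
          by (auto intro!: nn_integral_cong simp: indicator_def)
        then show ?case
          using nn_integral_eq_integral[OF elim] J_nonneg by simp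
      qed
    qed
    finally show "emeasure (distr M S Y) C = emeasure (density S (\<lambda>y. ennreal (LINT x|R. J y x))) C"
      by (simp add: emeasure_density)
  qed simp
  then show ?thesis by (simp add: distributed_def)
qed

text \<open>Joint density divided by marginal density. Where the marginal is 0 the quotient is 0 by
  convention, but \<open>Y\<close> almost surely avoids such values.\<close>

lemma joint_density_conditional:
  "has_conditional_density M R X S Y (\<lambda>y x. J y x / (LINT x|R. J y x))"
proof -
  interpret R: sigma_finite_measure R by (rule R)
  define m where "m y = (LINT x|R. J y x)" for y
  have [measurable]: "m \<in> borel_measurable S" unfolding m_def by measurable
  have m_nonneg: "0 \<le> m y" for y unfolding m_def by (simp add: J_nonneg)
  note dist = joint_density_marginal[folded m_def]
  have "AE \<omega> in M. integrable R (J (Y \<omega>)) \<and> 0 < m (Y \<omega>)"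
    using joint_density_integrable by (intro distributed_AE[OF dist]) auto
  then have pd: "AE \<omega> in M. prob_density R (\<lambda>x. J (Y \<omega>) x / m (Y \<omega>))"
  proof eventually_elim
    case (elim \<omega>)
    then show ?case
      using J_nonneg m_nonneg
      by (auto simp: prob_density_def has_bochner_integral_iff m_def)
  qed
  let ?F = "vimage_algebra (space M) Y S"
  interpret F: finite_measure_subalgebra M ?F
    by unfold_locales (rule subalgebra_vimage_algebra, measurable)
  have "AE \<omega> in M. real_cond_exp M ?F (indicator (X -` B \<inter> space M)) \<omega>
          = (LINT x:B|R. J (Y \<omega>) x / m (Y \<omega>))" if B [measurable]: "B \<in> sets R" for B
  proof -
    let ?ind = "indicator (X -` B \<inter> space M) :: _ \<Rightarrow> real"
    define g where "g y = (LINT x:B|R. J y x / m y)" for y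
    have g [measurable]: "g \<in> borel_measurable S"
      unfolding g_def set_lebesgue_integral_def by measurable
    have g_nonneg: "0 \<le> g y" for y
      unfolding g_def set_lebesgue_integral_def
      by (intro integral_nonneg_AE) (auto simp: J_nonneg m_nonneg indicator_def)
    \<comment> \<open>The marginal cancels the normalization in \<open>g\<close>. If
      \<open>m y = 0\<close>, then \<open>J y\<close> vanishes almost everywhere and both sides are
      0.\<close>
    have mg: "AE y in S. ennreal (m y) * ennreal (g y) = (\<integral>\<^sup>+x\<in>B. ennreal (J y x) \<partial>R)"
      using joint_density_integrable
    proof eventually_elim
      case (elim y)
      have iB: "integrable R (\<lambda>x. indicator B x *\<^sub>R J y x)"
        by (intro integrable_mult_indicator B elim)
      have "m y * g y = (LINT x|R. indicator B x *\<^sub>R J y x)"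
      proof (cases "m y = 0")
        case True
        then have "AE x in R. J y x = 0"
          unfolding m_def using integral_nonneg_eq_0_iff_AE[OF elim] J_nonneg by simp
        then have "(LINT x|R. indicator B x *\<^sub>R J y x) = (LINT x|R. 0)"
          using iB by (intro integral_cong_AE) auto
        with True show ?thesis by simp
      next
        case False
        then show ?thesis
          by (simp add: g_def set_lebesgue_integral_def)
      qed
      then have "ennreal (m y) * ennreal (g y) = (\<integral>\<^sup>+x. ennreal (indicator B x *\<^sub>R J y x) \<partial>R)"
        using nn_integral_eq_integral[OF iB] m_nonneg g_nonneg J_nonneg
        by (simp flip: ennreal_mult)
      also have "\<dots> = (\<integral>\<^sup>+x\<in>B. ennreal (J y x) \<partial>R)"
        by (intro nn_integral_cong) (auto simp: indicator_def)
      finally show ?case .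
    qed
    have gY: "(\<integral>\<^sup>+\<omega>. indicator C (Y \<omega>) * ennreal (g (Y \<omega>)) \<partial>M)
        = emeasure M (Y -` C \<inter> X -` B \<inter> space M)" if [measurable]: "C \<in> sets S" for C
    proof -
      have "(\<integral>\<^sup>+\<omega>. indicator C (Y \<omega>) * ennreal (g (Y \<omega>)) \<partial>M)
          = (\<integral>\<^sup>+y. ennreal (m y) * (indicator C y * ennreal (g y)) \<partial>S)"
        by (rule distributed_nn_integral[OF dist, symmetric]) measurable
      also have "\<dots> = (\<integral>\<^sup>+y\<in>C. (\<integral>\<^sup>+x\<in>B. ennreal (J y x) \<partial>R) \<partial>S)"
        by (rule nn_integral_cong_AE, use mg in eventually_elim) (auto simp: indicator_def)
      finally show ?thesis using rectangle[OF that B] by simp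
    qed
    \<comment> \<open>By \<open>gY\<close> with \<open>C = space S\<close>, the expectation of
      \<open>g\<close> at \<open>Y\<close> is a probability.\<close>
    have int_g: "integrable M (\<lambda>\<omega>. g (Y \<omega>))"
    proof (rule integrableI_nonneg)
      have "(\<integral>\<^sup>+\<omega>. ennreal (g (Y \<omega>)) \<partial>M)
          = (\<integral>\<^sup>+\<omega>. indicator (space S) (Y \<omega>) * ennreal (g (Y \<omega>)) \<partial>M)"
        using measurable_space[OF Y] by (auto intro!: nn_integral_cong simp: indicator_def)
      then show "(\<integral>\<^sup>+\<omega>. ennreal (g (Y \<omega>)) \<partial>M) < \<infinity>"
        by (simp add: gY emeasure_eq_measure)
    qed (auto simp: g_nonneg)
    \<comment> \<open>Conditional expectation is characterized by measurability with respect to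
      \<open>?F\<close> and by its integrals over sets of \<open>?F\<close>; the latter come from
      \<open>gY\<close>.\<close>
    have "AE \<omega> in M. real_cond_exp M ?F ?ind \<omega> = g (Y \<omega>)"
    proof (rule F.real_cond_exp_charact)
      show "integrable M ?ind" by (simp add: emeasure_eq_measure)
      show "integrable M (\<lambda>\<omega>. g (Y \<omega>))" by fact
      have "Y \<in> measurable ?F S"
        using measurable_space[OF Y] by (intro measurable_vimage_algebra1) auto
      then show "(\<lambda>\<omega>. g (Y \<omega>)) \<in> borel_measurable ?F" by measurable
      fix D assume "D \<in> sets ?F"
      then obtain C where C [measurable]: "C \<in> sets S" and D: "D = Y -` C \<inter> space M"
        using measurable_space[OF Y] by (auto simp: sets_vimage_algebra2)
      have DM [measurable]: "D \<in> sets M" unfolding D by measurable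
      have "(\<lambda>\<omega>. indicator D \<omega> *\<^sub>R ?ind \<omega>) = indicator (Y -` C \<inter> X -` B \<inter> space M)"
        by (auto simp: indicator_def D)
      then have "(LINT \<omega>:D|M. ?ind \<omega>) = measure M (Y -` C \<inter> X -` B \<inter> space M)"
        by (simp add: set_lebesgue_integral_def)
      also have "\<dots> = enn2real (\<integral>\<^sup>+\<omega>. indicator C (Y \<omega>) * ennreal (g (Y \<omega>)) \<partial>M)"
        by (simp add: gY measure_def)
      also have "\<dots> = enn2real (\<integral>\<^sup>+\<omega>. ennreal (indicator D \<omega> *\<^sub>R g (Y \<omega>)) \<partial>M)"
        by (intro arg_cong[where f = enn2real] nn_integral_cong) (auto simp: indicator_def D)
      also have "\<dots> = (LINT \<omega>:D|M. g (Y \<omega>))"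
        unfolding set_lebesgue_integral_def
        by (rule integral_eq_nn_integral[symmetric]) (auto simp: g_nonneg)
      finally show "(LINT \<omega>:D|M. ?ind \<omega>) = (LINT \<omega>:D|M. g (Y \<omega>))" .
    qed
    then show ?thesis by (simp add: g_def)
  qed
  with pd show ?thesis
    by (auto simp: has_conditional_density_def m_def)
qed

end

end

section \<open>Bayes' rule for the exponential family\<close>

theorem theorem1:
  fixes M :: "'w measure"
    and \<mu> :: "'a::euclidean_space measure"
    and \<nu> :: "'z measure"
    and X :: "'w \<Rightarrow> 'a" and Z :: "'w \<Rightarrow> 'z"
    and A :: "'a \<Rightarrow> 'b::euclidean_space"
    and h :: "'z \<Rightarrow> real" and T :: "'z \<Rightarrow> 'a"
    and \<theta>1 :: 'a and \<theta>2 \<theta>3 :: 'b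
  assumes "prob_space M"
    and "sigma_finite_measure \<mu>" and "sets \<mu> = sets borel"
    and "sigma_finite_measure \<nu>"
    and "exp_family_finite \<mu> A \<theta>1 \<theta>2"
    and "distributed M \<mu> X (\<lambda>x. ennreal (exp_family_density \<mu> A \<theta>1 \<theta>2 x))"
    and "\<And>x. prob_density \<nu> (\<lambda>z. h z * exp (x \<bullet> T z - \<theta>3 \<bullet> A x))"
    and "has_conditional_density M \<nu> Z \<mu> X (\<lambda>x z. h z * exp (x \<bullet> T z - \<theta>3 \<bullet> A x))"
  shows "(AE z in \<nu>. 0 < h z \<longrightarrow> exp_family_finite \<mu> A (\<theta>1 + T z) (\<theta>2 + \<theta>3)) \<and>
    distributed M \<nu> Z
      (\<lambda>z. ennreal (h z * (exp_family_H \<mu> A \<theta>1 \<theta>2 / exp_family_H \<mu> A (\<theta>1 + T z) (\<theta>2 + \<theta>3)))) \<and>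
    has_conditional_density M \<mu> X \<nu> Z
      (\<lambda>z x. exp_family_density \<mu> A (\<theta>1 + T z) (\<theta>2 + \<theta>3) x)"
proof -
  interpret M: prob_space M by fact
  interpret mu: sigma_finite_measure \<mu> by fact
  interpret nu: sigma_finite_measure \<nu> by fact
  interpret pair: pair_sigma_finite \<mu> \<nu> ..
  note [measurable_cong] = assms(3)
  define c where "c = exp_family_H \<mu> A \<theta>1 \<theta>2"
  define k where "k x z = h z * exp (x \<bullet> T z - \<theta>3 \<bullet> A x)" for x z
  define p where "p x = exp_family_density \<mu> A \<theta>1 \<theta>2 x" for x
  define e where "e z x = exp ((\<theta>1 + T z) \<bullet> x - (\<theta>2 + \<theta>3) \<bullet> A x)" for z x
  (* h may be negative on a null set, whence the truncation. *)
  define J where "J z x = p x * max 0 (k x z)" for z x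
  have k1: "has_bochner_integral \<nu> (k x) 1" for x
    using assms(7)[of x] by (simp add: prob_density_def k_def[abs_def])
  have k_meas: "k x \<in> borel_measurable \<nu>" for x
    using k1[of x] by (auto simp: has_bochner_integral_iff)
  \<comment> \<open>At \<open>x = 0\<close> the exponential is constant in \<open>z\<close>, so
    \<open>h\<close> inherits measurability from \<open>k 0\<close>.\<close>
  have h_eq: "h z = k 0 z * exp (\<theta>3 \<bullet> A 0)" for z
    by (simp add: k_def flip: exp_add)
  have h [measurable]: "h \<in> borel_measurable \<nu>"
    unfolding h_eq[abs_def] using k_meas[of 0] by measurable
  (* T is measurable only where h does not vanish. *)
  define T' where "T' z = (if h z = 0 then 0 else T z)" for z
  have T' [measurable]: "T' \<in> borel_measurable \<nu>"
  proof (subst borel_measurable_euclidean_space, intro ballI)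
    fix b :: 'a
    note k_meas[measurable]
    \<comment> \<open>Evaluating \<open>k\<close> at the basis vector \<open>b\<close> and taking a
      logarithm isolates one coordinate of \<open>T\<close>; the quotient is positive whatever the
      sign of \<open>h z\<close>.\<close>
    have "T' z \<bullet> b = (if h z = 0 then 0 else ln (k b z / h z) + \<theta>3 \<bullet> A b)" for z
      by (simp add: T'_def k_def inner_commute)
    then show "(\<lambda>z. T' z \<bullet> b) \<in> borel_measurable \<nu>"
      by simp
  qed
  have k_T': "k x z = h z * exp (x \<bullet> T' z) * exp (- (\<theta>3 \<bullet> A x))" for x z
    by (simp add: k_def T'_def exp_diff exp_minus field_simps)
  (* The normalization of k x expresses theta3.A(x) as the logarithm of a Laplace transform. *)
  have A3: "exp (- (\<theta>3 \<bullet> A x)) = inverse (LINT z|\<nu>. h z * exp (x \<bullet> T' z))" for x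
  proof -
    have "1 = (LINT z|\<nu>. k x z)"
      using k1 by (simp add: has_bochner_integral_iff)
    also have "\<dots> = (LINT z|\<nu>. h z * exp (x \<bullet> T' z)) * exp (- (\<theta>3 \<bullet> A x))"
      unfolding k_T' by simp
    finally show ?thesis by (simp add: field_simps exp_minus)
  qed
  \<comment> \<open>After rewriting with \<open>A3\<close>, \<open>A\<close> is gone: only
    \<open>h\<close>, \<open>T'\<close> and an integral over \<open>z\<close> depending measurably
    on \<open>x\<close> remain.\<close>
  have km [measurable]: "case_prod k \<in> borel_measurable (\<mu> \<Otimes>\<^sub>M \<nu>)"
    unfolding k_T'[abs_def] A3 by measurable
  have c_nonneg: "0 \<le> c" unfolding c_def exp_family_H_def by simp
  have p_nonneg: "0 \<le> p x" for x
    using c_nonneg unfolding p_def exp_family_density_def c_def by simp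
  \<comment> \<open>Integrability of the exponential in \<open>exp_family_finite\<close> includes
    its measurability.\<close>
  have [measurable]: "p \<in> borel_measurable \<mu>"
    using assms(5) unfolding p_def exp_family_density_def exp_family_finite_def by measurable
  have J_meas [measurable]: "case_prod J \<in> borel_measurable (\<nu> \<Otimes>\<^sub>M \<mu>)"
    unfolding J_def[abs_def] by measurable
  have J_nonneg: "0 \<le> J z x" for z x unfolding J_def by (simp add: p_nonneg)
  have k_cond: "has_conditional_density M \<nu> Z \<mu> X k"
    using assms(8) by (simp add: k_def[abs_def])
  then have [measurable]: "Z \<in> measurable M \<nu>" "X \<in> measurable M \<mu>"
    by (auto simp: has_conditional_density_def)
  \<comment> \<open>The density of \<open>X\<close> and the kernel \<open>k\<close> give the
    integral with \<open>x\<close> outermost; Tonelli reverses the order, so that \<open>Z\<close>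
    becomes the conditioning variable.\<close>
  have rect: "emeasure M (Z -` B \<inter> X -` C \<inter> space M)
      = (\<integral>\<^sup>+z\<in>B. (\<integral>\<^sup>+x\<in>C. ennreal (J z x) \<partial>\<mu>) \<partial>\<nu>)"
    if [measurable]: "B \<in> sets \<nu>" "C \<in> sets \<mu>" for B C
  proof -
    \<comment> \<open>\<open>ennreal\<close> sends negative reals to 0, in agreement with the
      truncation in \<open>J\<close>.\<close>
    have pk: "ennreal (p x) * ennreal (k x z) = ennreal (J z x)" for x z
      by (simp add: J_def p_nonneg ennreal_mult max_def ennreal_neg)
    have "emeasure M (Z -` B \<inter> X -` C \<inter> space M) = emeasure M (X -` C \<inter> Z -` B \<inter> space M)"
      by (simp add: Int_ac)
    also have "\<dots> = (\<integral>\<^sup>+x\<in>C. (\<integral>\<^sup>+z\<in>B. ennreal (J z x) \<partial>\<nu>) \<partial>\<mu>)"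
      unfolding pk[symmetric] using that assms(6)
      by (intro M.has_conditional_density_emeasure_rectangle assms(4) k_cond km) (auto simp: p_def)
    also have "\<dots> = (\<integral>\<^sup>+x. (\<integral>\<^sup>+z. ennreal (J z x) * indicator B z * indicator C x \<partial>\<nu>) \<partial>\<mu>)"
      by (intro nn_integral_cong nn_integral_multc[symmetric]) measurable
    also have "\<dots> = (\<integral>\<^sup>+z. (\<integral>\<^sup>+x. ennreal (J z x) * indicator B z * indicator C x \<partial>\<mu>) \<partial>\<nu>)"
      by (rule pair.Fubini'[symmetric]) measurable
    also have "\<dots> = (\<integral>\<^sup>+z. (\<integral>\<^sup>+x. (ennreal (J z x) * indicator C x) * indicator B z \<partial>\<mu>) \<partial>\<nu>)"
      by (simp add: ac_simps)
    also have "\<dots> = (\<integral>\<^sup>+z\<in>B. (\<integral>\<^sup>+x\<in>C. ennreal (J z x) \<partial>\<mu>) \<partial>\<nu>)"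
      by (intro nn_integral_cong nn_integral_multc) measurable
    finally show ?thesis .
  qed
  note joint = assms(2) \<open>Z \<in> measurable M \<nu>\<close> \<open>X \<in> measurable M \<mu>\<close> J_meas J_nonneg
  have joint_integrable: "AE z in \<nu>. integrable \<mu> (J z)"
    by (rule M.joint_density_integrable[where X = X and Y = Z and J = J, OF joint]) (rule rect)
  have joint_marginal: "distributed M \<nu> Z (\<lambda>z. ennreal (LINT x|\<mu>. J z x))"
    by (rule M.joint_density_marginal[where X = X and J = J, OF joint]) (rule rect)
  have joint_conditional:
    "has_conditional_density M \<mu> X \<nu> Z (\<lambda>z x. J z x / (LINT x|\<mu>. J z x))"
    by (rule M.joint_density_conditional[where J = J, OF joint]) (rule rect)
  \<comment> \<open>The sign of \<open>k x z\<close> is that of \<open>h z\<close>, and the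
    exponents add up to the updated parameters.\<close>
  have J_eq: "J z x = c * max 0 (h z) * e z x" for z x
  proof -
    have "max 0 (k x z) = max 0 (h z) * exp (x \<bullet> T z - \<theta>3 \<bullet> A x)"
      by (simp add: k_def max_def zero_le_mult_iff mult_le_0_iff)
    moreover have "e z x = exp (\<theta>1 \<bullet> x - \<theta>2 \<bullet> A x) * exp (x \<bullet> T z - \<theta>3 \<bullet> A x)"
      by (simp add: e_def inner_add_left inner_commute algebra_simps flip: exp_add)
    ultimately show ?thesis
      by (simp add: J_def p_def exp_family_density_def c_def)
  qed
  have H_eq: "exp_family_H \<mu> A (\<theta>1 + T z) (\<theta>2 + \<theta>3) = inverse (LINT x|\<mu>. e z x)" for z
    by (simp add: exp_family_H_def e_def)
  \<comment> \<open>This holds for every \<open>z\<close>: where the integral of \<open>e z\<close>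
    diverges, it and its inverse are 0 by convention, and where \<open>h z\<close> is negative both
    sides become 0 in \<open>ennreal\<close>.\<close>
  have m_eq: "ennreal (LINT x|\<mu>. J z x)
      = ennreal (h z * (c / exp_family_H \<mu> A (\<theta>1 + T z) (\<theta>2 + \<theta>3)))" for z
  proof -
    have "ennreal (LINT x|\<mu>. J z x) = ennreal (max 0 (h z) * (c * (LINT x|\<mu>. e z x)))"
      by (simp add: J_eq ac_simps)
    also have "\<dots> = ennreal (h z * (c * (LINT x|\<mu>. e z x)))"
    proof (cases "0 \<le> h z")
      case False
      then have "h z * (c * (LINT x|\<mu>. e z x)) \<le> 0"
        using c_nonneg by (intro mult_nonpos_nonneg mult_nonneg_nonneg) (auto simp: e_def)
      with False show ?thesis by (simp add: ennreal_neg)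
    qed simp
    also have "c * (LINT x|\<mu>. e z x) = c / exp_family_H \<mu> A (\<theta>1 + T z) (\<theta>2 + \<theta>3)"
      unfolding H_eq divide_inverse inverse_inverse_eq ..
    finally show ?thesis .
  qed
  have dist: "distributed M \<nu> Z
      (\<lambda>z. ennreal (h z * (c / exp_family_H \<mu> A (\<theta>1 + T z) (\<theta>2 + \<theta>3))))"
    using joint_marginal unfolding m_eq .
  \<comment> \<open>Were \<open>p\<close> zero almost everywhere, the law of \<open>X\<close> would
    be the null measure. This excludes \<open>c = 0\<close>.\<close>
  have "\<not> (AE x in \<mu>. p x = 0)"
  proof
    assume "AE x in \<mu>. p x = 0"
    then have "AE \<omega> in M. False"
      using assms(6) by (intro distributed_AE[where P = "\<lambda>_. False"]) (auto simp: p_def)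
    then show False by simp
  qed
  then have c_pos: "0 < c"
    using c_nonneg by (auto simp: p_def exp_family_density_def c_def less_le)
  \<comment> \<open>For \<open>h z\<close> positive, \<open>J z\<close> is a positive multiple of
    \<open>e z\<close>, so integrability carries over.\<close>
  have "AE z in \<nu>. 0 < h z \<longrightarrow> exp_family_finite \<mu> A (\<theta>1 + T z) (\<theta>2 + \<theta>3)"
    using joint_integrable
  proof eventually_elim
    case (elim z)
    then have "integrable \<mu> (\<lambda>x. c * max 0 (h z) * e z x)"
      by (simp add: J_eq[abs_def])
    then show ?case
      using c_pos by (auto simp: exp_family_finite_def e_def)
  qed
  moreover have "has_conditional_density M \<mu> X \<nu> Z
      (\<lambda>z x. exp_family_density \<mu> A (\<theta>1 + T z) (\<theta>2 + \<theta>3) x)"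
  proof (rule has_conditional_density_cong_AE[OF joint_conditional])
    \<comment> \<open>The marginal density of \<open>Z\<close> vanishes wherever \<open>h\<close> is
      not positive. Hence the factor \<open>c * h\<close> can be cancelled in the quotient at almost
      every value of \<open>Z\<close>, leaving \<open>e\<close> over its integral.\<close>
    have "AE \<omega> in M. 0 < h (Z \<omega>)"
    proof (rule distributed_AE[OF dist], intro AE_I2 impI)
      fix z assume "0 < ennreal (h z * (c / exp_family_H \<mu> A (\<theta>1 + T z) (\<theta>2 + \<theta>3)))"
      then have "0 < ennreal (LINT x|\<mu>. J z x)" by (simp add: m_eq)
      then show "0 < h z" by (cases "0 < h z") (auto simp: J_eq max_absorb1)
    qed
    then show "AE \<omega> in M. (\<lambda>x. J (Z \<omega>) x / (LINT x|\<mu>. J (Z \<omega>) x))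
        = exp_family_density \<mu> A (\<theta>1 + T (Z \<omega>)) (\<theta>2 + \<theta>3)"
    proof eventually_elim
      case (elim \<omega>)
      then show ?case
        using c_pos
        by (auto simp: fun_eq_iff J_eq exp_family_density_def H_eq e_def field_simps)
    qed
  qed
  ultimately show ?thesis
    using dist by (simp add: c_def)
qed

end
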